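(* Let $F,G:\mathbb{R}^d\to[0,\infty)$ satisfy the standing assumptions listed in the context, with $t_{\max}$, $\phi$, $K_{\max}$, $U^t$, $Z_t$ and $\pi^t$ as defined there. The curve $t\mapsto\pi^t$ is Lipschitz continuous on $[0,t_{\max})$ with respect to the total variation norm with Lipschitz constant $\frac{K_{\max}}{2Z_0}\Bigl(1+\frac{Z_{t_{\max}}}{Z_0}\Bigr)$, i.e., for all $s,t\in[0,t_{\max})$, $$\|\pi^s-\pi^t\|_{\mathrm{TV}}\le\frac{K_{\max}}{2Z_0}\Bigl(1+\frac{Z_{t_{\max}}}{Z_0}\Bigr)|s-t|.$$ If, in addition, for some $p\in[1,\infty)$ it holds that $$\int\|x\|^p\phi(\|x\|)^2\exp\bigl(-U^{t_{\max}}(x)\bigr)\,dx<\infty,$$ then $t\mapsto\pi^t$ is also Hölder continuous on $[0,t_{\max})$ with Hölder exponent $\frac1p$ with respect to the Wasserstein-$p$ distance.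
   Context: Notation: $B_R(m)=\{x\in\mathbb{R}^d:\|x-m\|\le R\}$ and $B_R^c(m)=\mathbb{R}^d\setminus B_R(m)$. The (regular) subdifferential of $H:\mathbb{R}^d\to\mathbb{R}$ at $x$ is $\partial H(x)=\{v\in\mathbb{R}^d:\liminf_{y\to x,\,y\ne x}\frac{H(y)-H(x)-\langle v,y-x\rangle}{\|y-x\|}\ge 0\}$. For $t>0$ the Moreau envelope is $M_H^t(x)=\inf_{y\in\mathbb{R}^d}H(y)+\frac1{2t}\|x-y\|^2$, with the convention $M_H^0=H$, and the proximal map is $\operatorname{prox}_{tH}(x)=\operatorname{argmin}_{y\in\mathbb{R}^d}H(y)+\frac1{2t}\|x-y\|^2$ (for $H=G$ and $t<1/\rho_G$ it is single-valued). Standing assumptions: $U=F+G$ with $\int\exp(-U(x))\,dx<\infty$, and (1) $F$ is differentiable with Lipschitz continuous gradient. (2) $G$ is locally bounded and weakly convex: there is $\rho_G>0$ such that $G+\frac{\rho_G}{2}\|\cdot\|^2$ is convex. In addition, $G$ is either Lipschitz continuous or satisfies $\int\exp(-G(x))\,dx<\infty$. (3) $F$ and $G$ are convex outside a ball: there is $M>0$ such that for all $x,y\in B_M^c(0)$ and $\lambda\in[0,1]$, $G(\lambda x+(1-\lambda)y)\le\lambda G(x)+(1-\lambda)G(y)$, and identically for $F$. (4) For a fixed $0<t_{\max}<1/\rho_G$ and $\phi(s)=\sup\{\|p\|: p\in\partial G(\operatorname{prox}_{tG}(x)),\ \|x\|\le s,\ 0<t\le t_{\max}\}$, it holds that $K_{\max}:=\int\phi(\|x\|)^2\exp(-U^{t_{\max}}(x))\,dx<\infty$.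 Here $U^t=F+M_G^t$, $Z_t=\int\exp(-U^t(y))\,dy$, and $\pi^t$ is the probability measure with density $\exp(-U^t(x))/Z_t$ (so $\pi^0=\pi\propto\exp(-U)$). $\|\mu-\nu\|_{\mathrm{TV}}=\sup_{A}|\mu(A)-\nu(A)|$ over Borel sets $A$, and $\mathcal{W}_p(\mu,\nu)=\inf_{\gamma}\bigl(\int\|x-y\|^p\,d\gamma(x,y)\bigr)^{1/p}$ over couplings $\gamma$ of $\mu$ and $\nu$. *)

theory Defs
  imports "HOL-Probability.Probability"
begin

definition subdifferential :: "('a::euclidean_space \<Rightarrow> real) \<Rightarrow> 'a \<Rightarrow> 'a set" where
  "subdifferential H x =
     {v. Liminf (at x) (\<lambda>y. ereal ((H y - H x - v \<bullet> (y - x)) / norm (y - x))) \<ge> 0}"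

text \<open>The infimum is taken in the reals, so the definition is meaningful only when
  \<open>H + norm\<^sup>2 / (2 t)\<close> is bounded below, e.g. for nonnegative \<open>H\<close>.\<close>

definition moreau_envelope :: "real \<Rightarrow> ('a::euclidean_space \<Rightarrow> real) \<Rightarrow> 'a \<Rightarrow> real" where
  "moreau_envelope t H x =
     (if t = 0 then H x else (INF y. H y + 1 / (2 * t) * (norm (x - y))\<^sup>2))"

text \<open>The set of all minimizers; no uniqueness is built in.\<close>

definition prox :: "real \<Rightarrow> ('a::euclidean_space \<Rightarrow> real) \<Rightarrow> 'a \<Rightarrow> 'a set" where
  "prox t H x =
     {y. is_arg_min (\<lambda>y. H y + 1 / (2 * t) * (norm (x - y))\<^sup>2) (\<lambda>_. True) y}"

definition subgrad_bound :: "('a::euclidean_space \<Rightarrow> real) \<Rightarrow> real \<Rightarrow> real \<Rightarrow> ennreal" where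
  "subgrad_bound G tmax s =
     Sup {ennreal (norm p) | p t x y.
            p \<in> subdifferential G y \<and> y \<in> prox t G x \<and> norm x \<le> s \<and> 0 < t \<and> t \<le> tmax}"

definition smoothed_potential ::
    "('a::euclidean_space \<Rightarrow> real) \<Rightarrow> ('a \<Rightarrow> real) \<Rightarrow> real \<Rightarrow> 'a \<Rightarrow> real" where
  "smoothed_potential F G t x = F x + moreau_envelope t G x"

definition K_max :: "('a::euclidean_space \<Rightarrow> real) \<Rightarrow> ('a \<Rightarrow> real) \<Rightarrow> real \<Rightarrow> ennreal" where
  "K_max F G tmax =
     (\<integral>\<^sup>+ x. (subgrad_bound G tmax (norm x))\<^sup>2
            * ennreal (exp (- smoothed_potential F G tmax x)) \<partial>lborel)"

definition partition_const :: "('a::euclidean_space \<Rightarrow> real) \<Rightarrow> ('a \<Rightarrow> real) \<Rightarrow> real \<Rightarrow> real" where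
  "partition_const F G t = (LINT x|lborel. exp (- smoothed_potential F G t x))"

definition smoothed_gibbs ::
    "('a::euclidean_space \<Rightarrow> real) \<Rightarrow> ('a \<Rightarrow> real) \<Rightarrow> real \<Rightarrow> 'a measure" where
  "smoothed_gibbs F G t =
     density lborel (\<lambda>x. ennreal (exp (- smoothed_potential F G t x) / partition_const F G t))"

text \<open>Real-valued supremum, intended for finite measures.\<close>

definition tv_dist :: "'a::topological_space measure \<Rightarrow> 'a measure \<Rightarrow> real" where
  "tv_dist \<mu> \<nu> = (SUP A \<in> sets borel. \<bar>measure \<mu> A - measure \<nu> A\<bar>)"

definition couplings :: "'a measure \<Rightarrow> 'a measure \<Rightarrow> ('a \<times> 'a) measure set" where
  "couplings \<mu> \<nu> =
     {\<gamma>. prob_space \<gamma> \<and> sets \<gamma> = sets (\<mu> \<Otimes>\<^sub>M \<nu>) \<and> distr \<gamma> \<mu> fst = \<mu> \<and> distr \<gamma> \<nu> snd = \<nu>}"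

definition ennreal_powr :: "ennreal \<Rightarrow> real \<Rightarrow> ennreal" where
  "ennreal_powr c a = (if c = \<top> then \<top> else ennreal (enn2real c powr a))"

definition wasserstein ::
    "real \<Rightarrow> 'a::euclidean_space measure \<Rightarrow> 'a measure \<Rightarrow> ennreal" where
  "wasserstein p \<mu> \<nu> =
     (INF \<gamma> \<in> couplings \<mu> \<nu>.
        ennreal_powr (\<integral>\<^sup>+ z. ennreal (norm (fst z - snd z) powr p) \<partial>\<gamma>) (1 / p))"

text \<open>Convexity outside a ball: the endpoints lie outside the ball, but the segment joining them
  may meet it.  This is why \<open>convex_on\<close>, which requires a convex domain, does not apply.\<close>

definition convex_outside_ball :: "real \<Rightarrow> ('a::euclidean_space \<Rightarrow> real) \<Rightarrow> bool" where
  "convex_outside_ball M H \<longleftrightarrow>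
     (\<forall>x \<in> - cball 0 M. \<forall>y \<in> - cball 0 M. \<forall>l \<in> {0..1}.
        H (l *\<^sub>R x + (1 - l) *\<^sub>R y) \<le> l * H x + (1 - l) * H y)"

end

theory Submission
  imports Defs
begin

text \<open>The minimiser \<open>y\<close> defining \<open>moreau_envelope t G x\<close> gives the subgradient \<open>(x - y) / t\<close>, so using it as
  a competitor at time \<open>s\<close> bounds the growth of the envelope by \<open>\<phi>(\<parallel>x\<parallel>)\<^sup>2 / 2\<close> per unit of time.  Hence
  \<open>e\<^sub>t = exp (- (F + M\<^sub>t))\<close> increases in \<open>t\<close> with \<open>e\<^sub>t - e\<^sub>s \<le> (t - s) / 2 * \<phi>\<^sup>2 * exp (- (F + M\<^bsub>tmax\<^esub>))\<close> pointwise, and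
  integrating this gives both the integrability of \<open>e\<^sub>t\<close> and the total variation estimate.  For the
  Wasserstein distance, keep the common mass of two densities in place and couple the remainders
  independently; this bounds \<open>W\<^sub>p\<^sup>p\<close> by the \<open>p\<close>-th moment of the absolute difference of the densities,
  to which the same pointwise estimate applies.\<close>

lemma bdd_below_moreau:
  assumes "\<And>x. 0 \<le> G x" "0 < t"
  shows "bdd_below (range (\<lambda>y. G y + 1 / (2 * t) * (norm (x - y))\<^sup>2))"
  by (rule bdd_belowI2[where m = 0]) (simp add: assms less_imp_le)

lemma moreau_envelope_le:
  assumes "\<And>x. 0 \<le> G x" "0 < t"
  shows "moreau_envelope t G x \<le> G y + 1 / (2 * t) * (norm (x - y))\<^sup>2"
  using cINF_lower[OF bdd_below_moreau[of G, OF assms], of y x] assms(2) by (simp add: moreau_envelope_def)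

lemma moreau_envelope_prox:
  assumes "y \<in> prox t G x" "t \<noteq> 0"
  shows "moreau_envelope t G x = G y + 1 / (2 * t) * (norm (x - y))\<^sup>2"
proof -
  have "G y + 1 / (2 * t) * (norm (x - y))\<^sup>2 \<le> G z + 1 / (2 * t) * (norm (x - z))\<^sup>2" for z
    using assms by (auto simp: prox_def is_arg_min_linorder)
  then show ?thesis
    using assms(2) by (auto simp: moreau_envelope_def intro!: cInf_eq_minimum)
qed

lemma prox_exists:
  fixes G :: "'a::euclidean_space \<Rightarrow> real"
  assumes G: "\<And>x. 0 \<le> G x" "continuous_on UNIV G" and t: "0 < t"
  shows "\<exists>y. y \<in> prox t G x"
proof -
  define h where "h y = G y + 1 / (2 * t) * (norm (x - y))\<^sup>2" for y
  define r where "r = sqrt (2 * t * G x)"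
  have "continuous_on (cball x r) h"
    unfolding h_def by (intro continuous_intros continuous_on_subset[OF G(2)]) auto
  moreover have r: "0 \<le> r" using G t by (auto simp: r_def)
  ultimately obtain y where y: "\<And>z. z \<in> cball x r \<Longrightarrow> h y \<le> h z"
    using continuous_attains_inf[of "cball x r" h] by (metis cball_eq_empty compact_cball not_less)
  have "h y \<le> h z" for z
  proof (cases "z \<in> cball x r")
    case False
    then have "r\<^sup>2 \<le> (norm (x - z))\<^sup>2"
      using r by (intro power_mono) (auto simp: dist_norm)
    then have "2 * t * G x \<le> (norm (x - z))\<^sup>2"
      using G t by (simp add: r_def)
    then have "G x \<le> 1 / (2 * t) * (norm (x - z))\<^sup>2"
      using t by (simp add: field_simps)
    moreover have "h y \<le> h x" using r by (intro y) auto
    ultimately show ?thesis using G(1)[of z] by (simp add: h_def)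
  qed (rule y)
  then show ?thesis by (auto simp: prox_def is_arg_min_linorder h_def)
qed

lemma prox_subdifferential:
  assumes y: "y \<in> prox t G x" and t: "0 < t"
  shows "(1 / t) *\<^sub>R (x - y) \<in> subdifferential G y"
proof -
  define p where "p = (1 / t) *\<^sub>R (x - y)"
  have lb: "- (norm (z - y) / (2 * t)) \<le> (G z - G y - p \<bullet> (z - y)) / norm (z - y)" if "z \<noteq> y" for z
  proof -
    have "G y + 1 / (2 * t) * (norm (x - y))\<^sup>2 \<le> G z + 1 / (2 * t) * (norm (x - z))\<^sup>2"
      using y by (auto simp: prox_def is_arg_min_linorder)
    moreover have "(norm (x - z))\<^sup>2 = (norm (x - y))\<^sup>2 - 2 * ((x - y) \<bullet> (z - y)) + (norm (z - y))\<^sup>2"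
      unfolding power2_norm_eq_inner by (simp add: inner_diff inner_commute algebra_simps)
    moreover have "(x - y) \<bullet> (z - y) = t * (p \<bullet> (z - y))"
      using t by (simp add: p_def)
    ultimately have "G y + 1 / (2 * t) * (norm (x - y))\<^sup>2
        \<le> G z + 1 / (2 * t) * ((norm (x - y))\<^sup>2 - 2 * (t * (p \<bullet> (z - y))) + (norm (z - y))\<^sup>2)"
      by simp
    also have "\<dots> = G z + 1 / (2 * t) * (norm (x - y))\<^sup>2 - p \<bullet> (z - y) + (norm (z - y))\<^sup>2 / (2 * t)"
      using t by (simp add: field_simps)
    finally have "- ((norm (z - y))\<^sup>2 / (2 * t)) \<le> G z - G y - p \<bullet> (z - y)" by simp
    then show ?thesis using that t by (simp add: field_simps power2_eq_square)
  qed
  have "((\<lambda>z. ereal (- (norm (z - y) / (2 * t)))) \<longlongrightarrow> ereal (- (norm (y - y) / (2 * t)))) (at y)"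
    using t by (intro tendsto_ereal tendsto_minus tendsto_divide tendsto_norm tendsto_diff) auto
  from lim_imp_Liminf[OF _ this]
  have "0 = Liminf (at y) (\<lambda>z. ereal (- (norm (z - y) / (2 * t))))" by (simp add: zero_ereal_def)
  also have "\<dots> \<le> Liminf (at y) (\<lambda>z. ereal ((G z - G y - p \<bullet> (z - y)) / norm (z - y)))"
    using lb by (intro Liminf_mono eventually_mono[OF eventually_neq_at_within[of y]]) auto
  finally show ?thesis by (simp add: subdifferential_def p_def)
qed

lemma norm_prox_le_subgrad_bound:
  assumes "y \<in> prox t G x" "0 < t" "t \<le> tmax"
  shows "ennreal (norm (x - y) / t) \<le> subgrad_bound G tmax (norm x)"
  unfolding subgrad_bound_def
  using assms prox_subdifferential[OF assms(1,2)]
  by (intro Sup_upper CollectI exI[of _ "(1 / t) *\<^sub>R (x - y)"] exI[of _ t] exI[of _ x] exI[of _ y]) auto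

lemma subgrad_bound_mono: "s \<le> s' \<Longrightarrow> subgrad_bound G tmax s \<le> subgrad_bound G tmax s'"
  unfolding subgrad_bound_def by (intro Sup_subset_mono) force

lemma moreau_envelope_antimono:
  assumes "\<And>x. 0 \<le> G x" "0 \<le> s" "s \<le> t"
  shows "moreau_envelope t G x \<le> moreau_envelope s G x"
proof (cases "s = 0")
  case True
  then show ?thesis
    using moreau_envelope_le[of G t x x] assms by (cases "t = 0") (auto simp: moreau_envelope_def)
next
  case False
  then have "moreau_envelope t G x \<le> G y + 1 / (2 * s) * (norm (x - y))\<^sup>2" for y
    using assms
    by (intro order_trans[OF moreau_envelope_le[of G t x y]] add_mono mult_right_mono divide_left_mono) auto
  then show ?thesis
    using False unfolding moreau_envelope_def[of s] by (auto intro!: cINF_greatest)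
qed

lemma moreau_envelope_diff_le:
  fixes G :: "'a::euclidean_space \<Rightarrow> real"
  assumes G: "\<And>x. 0 \<le> G x" "continuous_on UNIV G"
    and st: "0 < s" "s \<le> t" "t \<le> tmax"
    and c: "0 \<le> c" "subgrad_bound G tmax (norm x) \<le> ennreal c"
  shows "moreau_envelope s G x - moreau_envelope t G x \<le> c\<^sup>2 / 2 * (t / s) * (t - s)"
proof -
  obtain y where y: "y \<in> prox t G x" using prox_exists[OF G, of t] st by auto
  have "ennreal (norm (x - y) / t) \<le> ennreal c"
    using norm_prox_le_subgrad_bound[OF y, of tmax] st c(2) by (intro order_trans[OF _ c(2)]) auto
  then have "norm (x - y) \<le> c * t" using c st by (simp add: field_simps)
  then have n: "(norm (x - y))\<^sup>2 \<le> (c * t)\<^sup>2" by (intro power_mono) auto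
  have "moreau_envelope s G x - moreau_envelope t G x
      \<le> (1 / (2 * s) - 1 / (2 * t)) * (norm (x - y))\<^sup>2"
    using moreau_envelope_le[of G s x y] G(1) moreau_envelope_prox[OF y] st
    by (simp add: algebra_simps)
  also have "\<dots> \<le> (1 / (2 * s) - 1 / (2 * t)) * (c * t)\<^sup>2"
    using st by (intro mult_left_mono n) (auto simp: field_simps)
  also have "\<dots> = c\<^sup>2 / 2 * (t / s) * (t - s)"
    using st by (simp add: field_simps power2_eq_square)
  finally show ?thesis .
qed

text \<open>The factor \<open>t / s\<close> is removed by subdividing \<open>[s, t]\<close> into short intervals.\<close>
lemma moreau_envelope_lipschitz_pos:
  fixes G :: "'a::euclidean_space \<Rightarrow> real"
  assumes G: "\<And>x. 0 \<le> G x" "continuous_on UNIV G"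
    and st: "0 < s" "s \<le> t" "t \<le> tmax"
    and c: "0 \<le> c" "subgrad_bound G tmax (norm x) \<le> ennreal c"
  shows "moreau_envelope s G x - moreau_envelope t G x \<le> c\<^sup>2 / 2 * (t - s)"
proof -
  define f where "f u = moreau_envelope u G x" for u
  have step: "f s - f t \<le> c\<^sup>2 / 2 * (1 + (t - s) / (real (Suc n) * s)) * (t - s)" for n
  proof -
    define d where "d = (t - s) / real (Suc n)"
    define k where "k = c\<^sup>2 / 2 * (1 + d / s)"
    have d: "0 \<le> d" "real (Suc n) * d = t - s" using st by (auto simp: d_def)
    have "i \<le> Suc n \<Longrightarrow> f s - f (s + real i * d) \<le> k * (real i * d)" for i
    proof (induction i)
      case (Suc i)
      have "real (Suc i) * d \<le> real (Suc n) * d"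
        using d Suc.prems by (intro mult_right_mono) simp_all
      then have le: "s + real (Suc i) * d \<le> tmax" using d st by linarith
      have pos: "0 < s + real i * d" using st d by (simp add: add_pos_nonneg)
      have "f (s + real i * d) - f (s + real (Suc i) * d)
          \<le> c\<^sup>2 / 2 * ((s + real (Suc i) * d) / (s + real i * d)) * ((s + real (Suc i) * d) - (s + real i * d))"
        unfolding f_def
        by (rule moreau_envelope_diff_le[OF G pos _ le c]) (use d in \<open>auto simp: algebra_simps\<close>)
      also have "\<dots> \<le> k * d"
      proof -
        have "(s + real (Suc i) * d) / (s + real i * d) = 1 + d / (s + real i * d)"
          using pos by (simp add: field_simps)
        also have "\<dots> \<le> 1 + d / s"
          using pos d st by (auto intro!: divide_left_mono)
        finally have "c\<^sup>2 / 2 * ((s + real (Suc i) * d) / (s + real i * d)) * d \<le> k * d"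
          unfolding k_def using d(1) by (intro mult_right_mono mult_left_mono) simp_all
        then show ?thesis by (simp only: of_nat_Suc) (simp add: algebra_simps)
      qed
      finally show ?case using Suc.IH Suc.prems by (simp add: algebra_simps)
    qed simp
    from this[of "Suc n"] show ?thesis using d by (simp add: d_def k_def)
  qed
  have "(\<lambda>n. (t - s) / s * inverse (real (Suc n))) \<longlonglongrightarrow> (t - s) / s * 0"
    by (intro tendsto_mult_left LIMSEQ_inverse_real_of_nat)
  moreover have "(t - s) / s * inverse (real (Suc n)) = (t - s) / (real (Suc n) * s)" for n
    by (simp add: divide_inverse)
  ultimately have "(\<lambda>n. (t - s) / (real (Suc n) * s)) \<longlonglongrightarrow> 0" by simp
  then have "(\<lambda>n. c\<^sup>2 / 2 * (1 + (t - s) / (real (Suc n) * s)) * (t - s)) \<longlonglongrightarrow> c\<^sup>2 / 2 * (1 + 0) * (t - s)"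
    by (intro tendsto_mult_right tendsto_mult_left tendsto_add tendsto_const)
  then have "f s - f t \<le> c\<^sup>2 / 2 * (1 + 0) * (t - s)"
    by (rule LIMSEQ_le_const) (intro exI allI impI step)
  then show ?thesis by (simp add: f_def)
qed

lemma moreau_envelope_lipschitz:
  fixes G :: "'a::euclidean_space \<Rightarrow> real"
  assumes G: "\<And>x. 0 \<le> G x" "continuous_on UNIV G"
    and st: "0 \<le> s" "s \<le> t" "t \<le> tmax"
    and c: "0 \<le> c" "subgrad_bound G tmax (norm x) \<le> ennreal c"
  shows "moreau_envelope s G x - moreau_envelope t G x \<le> c\<^sup>2 / 2 * (t - s)"
proof -
  consider "0 < s" | "s = 0" "t = 0" | "s = 0" "0 < t" using st by linarith
  then show ?thesis
  proof cases
    case 1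
    then show ?thesis using moreau_envelope_lipschitz_pos[OF G _ _ _ c] st by auto
  next
    case 3
    define u where "u n = t * inverse (real (Suc n))" for n
    have u: "0 < u n" "u n \<le> t" for n using 3 by (auto simp: u_def field_simps)
    have "\<forall>n. \<exists>y. y \<in> prox (u n) G x"
      by (rule allI, rule prox_exists[OF G u(1)])
    then obtain y where "\<forall>n. y n \<in> prox (u n) G x" by (rule choice[THEN exE])
    then have y: "y n \<in> prox (u n) G x" for n by blast
    have u0: "u \<longlonglongrightarrow> t * 0"
      unfolding u_def by (intro tendsto_mult_left LIMSEQ_inverse_real_of_nat)
    have dist: "norm (y n - x) \<le> u n * c" for n
    proof -
      have "ennreal (norm (x - y n) / u n) \<le> ennreal c"
        using u[of n] st by (intro order_trans[OF norm_prox_le_subgrad_bound[OF y] c(2)]) auto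
      then show ?thesis using c u(1)[of n] by (simp add: field_simps norm_minus_commute)
    qed
    have "(\<lambda>n. u n * c) \<longlonglongrightarrow> 0"
      using tendsto_mult_right[OF u0, of c] by simp
    then have "(\<lambda>n. y n - x) \<longlonglongrightarrow> 0"
      by (rule Lim_null_comparison[rotated]) (rule always_eventually[OF allI], rule dist)
    then have "y \<longlonglongrightarrow> x" by (simp add: LIM_zero_iff)
    then have lim: "(\<lambda>n. G (y n)) \<longlonglongrightarrow> G x"
      using G(2) by (intro isCont_tendsto_compose[of x G]) (auto simp: continuous_on_eq_continuous_at)
    have "G (y n) \<le> moreau_envelope t G x + c\<^sup>2 / 2 * t" for n
    proof -
      have "G (y n) \<le> moreau_envelope (u n) G x"
        using moreau_envelope_prox[OF y, of n] u(1)[of n] by simp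
      also have "\<dots> \<le> moreau_envelope t G x + c\<^sup>2 / 2 * (t - u n)"
        using moreau_envelope_lipschitz_pos[OF G u st(3) c, of n] by simp
      also have "\<dots> \<le> moreau_envelope t G x + c\<^sup>2 / 2 * t"
        using u(1)[of n] by (intro add_left_mono mult_left_mono) auto
      finally show ?thesis .
    qed
    then have "G x \<le> moreau_envelope t G x + c\<^sup>2 / 2 * t"
      by (intro LIMSEQ_le_const2[OF lim] exI allI impI)
    then show ?thesis using 3 by (simp add: moreau_envelope_def[of 0])
  qed simp
qed

lemma exp_smoothed_potential_mono:
  assumes "\<And>x. 0 \<le> G x" "0 \<le> s" "s \<le> t"
  shows "exp (- smoothed_potential F G s x) \<le> exp (- smoothed_potential F G t x)"
  using moreau_envelope_antimono[of G s t x] assms by (simp add: smoothed_potential_def)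

lemma exp_smoothed_potential_diff_le:
  fixes F G :: "'a::euclidean_space \<Rightarrow> real"
  assumes G: "\<And>x. 0 \<le> G x" "continuous_on UNIV G"
    and st: "0 \<le> s" "s \<le> t" "t \<le> tmax"
  shows "ennreal (exp (- smoothed_potential F G t x) - exp (- smoothed_potential F G s x))
     \<le> ennreal ((t - s) / 2) *
        ((subgrad_bound G tmax (norm x))\<^sup>2 * ennreal (exp (- smoothed_potential F G tmax x)))"
proof (cases "s = t")
  case False
  then have "s < t" using st by simp
  show ?thesis
  proof (cases "subgrad_bound G tmax (norm x)")
    case top
    then show ?thesis using \<open>s < t\<close> by (simp add: ennreal_mult_top ennreal_top_mult)
  next
    case (real c)
    define a b m where "a = smoothed_potential F G s x" "b = smoothed_potential F G t x"
      "m = smoothed_potential F G tmax x"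
    have "exp (- b) - exp (- a) = exp (- b) * (1 - exp (b - a))"
      by (simp add: right_diff_distrib mult_exp_exp)
    also have "\<dots> \<le> exp (- b) * (a - b)"
    proof (intro mult_left_mono)
      show "1 - exp (b - a) \<le> a - b" using exp_ge_add_one_self[of "b - a"] by linarith
    qed simp
    also have "\<dots> \<le> exp (- m) * (c\<^sup>2 / 2 * (t - s))"
    proof (intro mult_mono)
      show "exp (- b) \<le> exp (- m)"
        unfolding a_b_m_def using exp_smoothed_potential_mono[of G t tmax] G st by auto
      show "a - b \<le> c\<^sup>2 / 2 * (t - s)"
        using moreau_envelope_lipschitz[OF G st, of c x] real
        by (simp add: a_b_m_def smoothed_potential_def)
      show "0 \<le> a - b"
        using moreau_envelope_antimono[of G s t x] G st by (simp add: a_b_m_def smoothed_potential_def)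
    qed auto
    finally have "ennreal (exp (- b) - exp (- a)) \<le> ennreal ((t - s) / 2 * (c\<^sup>2 * exp (- m)))"
      by (intro ennreal_leI) (simp add: algebra_simps)
    also have "\<dots> = ennreal ((t - s) / 2) * ((ennreal c)\<^sup>2 * ennreal (exp (- m)))"
    proof -
      have "0 \<le> (t - s) / 2" "0 \<le> c\<^sup>2 * exp (- m)" "0 \<le> c\<^sup>2" "0 \<le> exp (- m)"
        using \<open>s < t\<close> by simp_all
      then show ?thesis by (simp only: ennreal_mult ennreal_power[OF real(1)])
    qed
    finally show ?thesis unfolding a_b_m_def real(2) .
  qed
qed simp

lemma borel_measurable_moreau_envelope:
  fixes G :: "'a::euclidean_space \<Rightarrow> real"
  assumes G: "\<And>x. 0 \<le> G x" "continuous_on UNIV G" and t: "0 \<le> t"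
  shows "moreau_envelope t G \<in> borel_measurable borel"
proof (cases "t = 0")
  case True
  then show ?thesis
    using borel_measurable_continuous_onI[OF G(2)] by (simp add: moreau_envelope_def[abs_def])
next
  case False
  then have t: "0 < t" using t by simp
  show ?thesis
  proof (rule borel_measurableI_less)
    fix a
    have "moreau_envelope t G x < a \<longleftrightarrow> (\<exists>y. G y + 1 / (2 * t) * (norm (x - y))\<^sup>2 < a)" for x
      using cINF_less_iff[OF _ bdd_below_moreau[of G, OF G(1) t], of x a] t
      unfolding moreau_envelope_def by simp
    then have "{x. moreau_envelope t G x < a} = (\<Union>y. {x. G y + 1 / (2 * t) * (norm (x - y))\<^sup>2 < a})"
      by blast
    moreover have "open (\<Union>y. {x. G y + 1 / (2 * t) * (norm (x - y))\<^sup>2 < a})"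
      by (intro open_UN ballI open_Collect_less continuous_intros)
    ultimately show "{x \<in> space borel. moreau_envelope t G x < a} \<in> sets borel" by simp
  qed
qed

lemma borel_measurable_mono_ennreal:
  fixes f :: "real \<Rightarrow> ennreal"
  assumes "mono f"
  shows "f \<in> borel_measurable borel"
proof (rule borel_measurableI_greater)
  fix a
  have "mono (indicator {x. a < f x} :: real \<Rightarrow> real)"
  proof (rule monoI)
    fix x y :: real assume "x \<le> y"
    then have "a < f y" if "a < f x" using that monoD[OF assms] by (blast intro: less_le_trans)
    then show "(indicator {x. a < f x} x :: real) \<le> indicator {x. a < f x} y"
      by (cases "a < f x") simp_all
  qed
  then have "(indicator {x. a < f x} :: real \<Rightarrow> real) \<in> borel_measurable borel"
    by (rule borel_measurable_mono)
  then have "{x. a < f x} \<inter> space borel \<in> sets borel"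
    by (rule borel_measurable_indicator_iff[THEN iffD1])
  then show "{x \<in> space borel. a < f x} \<in> sets borel" by simp
qed

definition add_measure :: "'a measure \<Rightarrow> 'a measure \<Rightarrow> 'a measure" where
  "add_measure M N = measure_of (space M) (sets M) (\<lambda>A. emeasure M A + emeasure N A)"

lemma sets_add_measure [simp]: "sets (add_measure M N) = sets M"
  and space_add_measure [simp]: "space (add_measure M N) = space M"
  by (simp_all add: add_measure_def)

lemma emeasure_add_measure:
  assumes sets: "sets N = sets M" and A: "A \<in> sets M"
  shows "emeasure (add_measure M N) A = emeasure M A + emeasure N A"
proof (rule emeasure_measure_of[OF add_measure_def])
  show "countably_additive (sets (add_measure M N)) (\<lambda>A. emeasure M A + emeasure N A)"
  proof (rule countably_additiveI)
    fix X :: "nat \<Rightarrow> 'a set"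
    assume X: "range X \<subseteq> sets (add_measure M N)" "disjoint_family X"
    then have "(\<Sum>i. emeasure M (X i)) = emeasure M (\<Union>i. X i)"
      "(\<Sum>i. emeasure N (X i)) = emeasure N (\<Union>i. X i)"
      by (auto intro!: suminf_emeasure simp: sets)
    then show "(\<Sum>i. emeasure M (X i) + emeasure N (X i)) = emeasure M (\<Union>i. X i) + emeasure N (\<Union>i. X i)"
      by (simp add: suminf_add[symmetric])
  qed
qed (use A in \<open>auto simp: positive_def sets.sets_into_space dest: sets.sets_into_space\<close>)

lemma nn_integral_add_measure:
  assumes sets: "sets N = sets M" and f: "f \<in> borel_measurable M"
  shows "integral\<^sup>N (add_measure M N) f = integral\<^sup>N M f + integral\<^sup>N N f"
proof -
  have meas: "h \<in> borel_measurable (add_measure M N)" "h \<in> borel_measurable N"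
    if "h \<in> borel_measurable M" for h :: "'a \<Rightarrow> ennreal"
    using that by (simp_all add: measurable_cong_sets[OF sets refl] measurable_cong_sets[OF sets_add_measure refl])
  show ?thesis using f
  proof (induction rule: borel_measurable_induct)
    case (cong f g)
    have "integral\<^sup>N L f = integral\<^sup>N L g" if "space L = space M" for L
      using cong(3) that by (intro nn_integral_cong) auto
    then show ?case using cong(4) sets_eq_imp_space_eq[OF sets] by simp
  next
    case (set A)
    then show ?case using sets by (simp add: emeasure_add_measure)
  next
    case (mult u c)
    then show ?case by (simp add: nn_integral_cmult meas distrib_left)
  next
    case (add u v)
    then show ?case by (simp add: nn_integral_add meas ac_simps)
  next
    case (seq U)
    have SUP: "integral\<^sup>N L (SUP i. U i) = (SUP i. integral\<^sup>N L (U i))" if "\<And>i. U i \<in> borel_measurable L" for L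
    proof -
      have "(\<integral>\<^sup>+x. (SUP i. U i x) \<partial>L) = (SUP i. integral\<^sup>N L (U i))"
        using seq(3) that by (rule nn_integral_monotone_convergence_SUP)
      moreover have "(SUP i. U i) = (\<lambda>x. SUP i. U i x)" by (auto simp: fun_eq_iff image_comp)
      ultimately show ?thesis by simp
    qed
    have inc: "incseq (\<lambda>i. integral\<^sup>N L (U i))" for L
      using seq(3) by (auto simp: mono_def le_fun_def intro!: nn_integral_mono)
    have U: "U i \<in> borel_measurable (add_measure M N)" "U i \<in> borel_measurable N" for i
      using seq(1) by (auto intro: meas)
    show ?case
      unfolding SUP[OF seq(1)] SUP[OF U(1)] SUP[OF U(2)] seq.IH by (rule ennreal_SUP_add[OF inc inc])
  qed
qed

lemma ennreal_powr_mono: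
  assumes "c \<le> d" "0 \<le> a"
  shows "ennreal_powr c a \<le> ennreal_powr d a"
proof (cases "d = \<top>")
  case False
  then have "c < \<top>" "d < \<top>" using assms by (auto simp: less_top top_unique)
  then show ?thesis
    using assms by (auto simp: ennreal_powr_def intro!: powr_mono2 ennreal_leI enn2real_mono)
qed (simp add: ennreal_powr_def)

lemma norm_diff_powr_le:
  fixes x y :: "'a::real_normed_vector"
  assumes "0 \<le> p"
  shows "norm (x - y) powr p \<le> 2 powr p * (norm x powr p + norm y powr p)"
proof -
  have "norm (x - y) \<le> 2 * max (norm x) (norm y)"
    using norm_triangle_ineq4[of x y] by linarith
  then have "norm (x - y) powr p \<le> (2 * max (norm x) (norm y)) powr p"
    using assms by (intro powr_mono2) auto
  also have "\<dots> = 2 powr p * max (norm x) (norm y) powr p"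
    by (rule powr_mult)
  also have "\<dots> \<le> 2 powr p * (norm x powr p + norm y powr p)"
    by (intro mult_left_mono) (auto simp: max_def)
  finally show ?thesis .
qed

text \<open>The coupling leaves the common mass \<open>min f g\<close> in place and moves the rest independently.\<close>
lemma wasserstein_density_le:
  fixes f g :: "'a::euclidean_space \<Rightarrow> real"
  assumes [measurable]: "f \<in> borel_measurable borel" "g \<in> borel_measurable borel"
    and nonneg: "\<And>x. 0 \<le> f x" "\<And>x. 0 \<le> g x"
    and f1: "(\<integral>\<^sup>+x. ennreal (f x) \<partial>lborel) = 1" and g1: "(\<integral>\<^sup>+x. ennreal (g x) \<partial>lborel) = 1"
    and p: "0 \<le> p"
  shows "wasserstein p (density lborel (\<lambda>x. ennreal (f x))) (density lborel (\<lambda>x. ennreal (g x)))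
    \<le> ennreal_powr (ennreal (2 powr p) * (\<integral>\<^sup>+x. ennreal (norm x powr p) * ennreal \<bar>f x - g x\<bar> \<partial>lborel)) (1 / p)"
proof -
  define m a b where "m x = ennreal (min (f x) (g x))"
    and "a x = ennreal (f x - min (f x) (g x))" and "b x = ennreal (g x - min (f x) (g x))" for x
  have [measurable]: "m \<in> borel_measurable borel" "a \<in> borel_measurable borel" "b \<in> borel_measurable borel"
    by (auto simp: m_def[abs_def] a_def[abs_def] b_def[abs_def])
  have f_eq: "ennreal (f x) = m x + a x" and g_eq: "ennreal (g x) = m x + b x"
    and ab: "a x + b x = ennreal \<bar>f x - g x\<bar>" for x
    using nonneg[of x] by (auto simp: m_def a_def b_def simp flip: ennreal_plus)
  define \<delta> where "\<delta> = (\<integral>\<^sup>+x. a x \<partial>lborel)"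
  have fm: "(\<integral>\<^sup>+x. m x \<partial>lborel) + \<delta> = 1"
    using f1 by (simp add: f_eq nn_integral_add \<delta>_def)
  have gm: "(\<integral>\<^sup>+x. m x \<partial>lborel) + (\<integral>\<^sup>+x. b x \<partial>lborel) = 1"
    using g1 by (simp add: g_eq nn_integral_add)
  have "(\<integral>\<^sup>+x. m x \<partial>lborel) \<noteq> \<top>"
    using fm by auto
  then have b_int: "(\<integral>\<^sup>+x. b x \<partial>lborel) = \<delta>"
    using fm gm ennreal_add_left_cancel[of "integral\<^sup>N lborel m" "integral\<^sup>N lborel b" \<delta>] by simp
  have "\<delta> \<noteq> \<top>" using fm by auto
  then have "\<delta> < \<top>" by (simp add: less_top)
  define k where "k = ennreal (inverse (enn2real \<delta>))"
  have k: "k * \<delta> = (if \<delta> = 0 then 0 else 1)"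
  proof (cases \<delta>)
    case (real r)
    then show ?thesis by (auto simp: k_def ennreal_mult[symmetric])
  qed (use \<open>\<delta> < \<top>\<close> in simp)
  have k_cancel: "u * (k * \<delta>) = u" if "u \<le> \<delta>" for u
    using that by (auto simp: k)
  define \<mu> \<nu> where "\<mu> = density lborel (\<lambda>x. ennreal (f x))" and "\<nu> = density lborel (\<lambda>x. ennreal (g x))"
  define N1 N2 where "N1 = density lborel a" and "N2 = density lborel (\<lambda>x. k * b x)"
  define D where "D = distr (density lborel m) (borel \<Otimes>\<^sub>M borel) (\<lambda>x. (x, x))"
  define \<gamma> where "\<gamma> = add_measure D (N1 \<Otimes>\<^sub>M N2)"
  have [simp]: "sets N1 = sets borel" "sets N2 = sets borel" "sets \<mu> = sets borel" "sets \<nu> = sets borel"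
    "space N1 = UNIV" "space N2 = UNIV" "space \<mu> = UNIV" "space \<nu> = UNIV"
    by (simp_all add: N1_def N2_def \<mu>_def \<nu>_def)
  have [simp]: "sets D = sets (borel \<Otimes>\<^sub>M borel)" by (simp add: D_def)
  have N_sets: "sets (N1 \<Otimes>\<^sub>M N2) = sets (borel \<Otimes>\<^sub>M borel)"
    by (intro sets_pair_measure_cong) auto
  have \<gamma>_sets: "sets \<gamma> = sets (borel \<Otimes>\<^sub>M borel)" by (simp add: \<gamma>_def)
  have N1_UNIV: "emeasure N1 UNIV = \<delta>" by (simp add: N1_def emeasure_density \<delta>_def)
  have N2_UNIV: "emeasure N2 UNIV = k * \<delta>" by (simp add: N2_def emeasure_density nn_integral_cmult b_int)
  interpret N2: finite_measure N2
    by (rule finite_measureI) (simp add: N2_UNIV k)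
  have D_emeasure: "emeasure D (A \<times> B) = (\<integral>\<^sup>+x\<in>A \<inter> B. m x \<partial>lborel)"
    if [measurable]: "A \<in> sets borel" "B \<in> sets borel" for A B
  proof -
    have "(\<lambda>x. (x, x)) -` (A \<times> B) = A \<inter> B" by auto
    then show ?thesis by (simp add: D_def emeasure_distr emeasure_density)
  qed
  have \<gamma>_emeasure: "emeasure \<gamma> (A \<times> B) = (\<integral>\<^sup>+x\<in>A \<inter> B. m x \<partial>lborel) + emeasure N1 A * emeasure N2 B"
    if [measurable]: "A \<in> sets borel" "B \<in> sets borel" for A B
    by (simp add: \<gamma>_def emeasure_add_measure N_sets D_emeasure N2.emeasure_pair_measure_Times)
  have marg1: "emeasure \<gamma> (A \<times> UNIV) = emeasure \<mu> A" if [measurable]: "A \<in> sets borel" for A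
  proof -
    have "(\<integral>\<^sup>+x\<in>A. a x \<partial>lborel) \<le> \<delta>"
      unfolding \<delta>_def by (intro nn_integral_mono) (simp add: indicator_def)
    then have "emeasure N1 A * emeasure N2 UNIV = (\<integral>\<^sup>+x\<in>A. a x \<partial>lborel)"
      unfolding N2_UNIV by (simp add: N1_def emeasure_density k_cancel)
    then show ?thesis
      by (simp add: \<gamma>_emeasure \<mu>_def emeasure_density f_eq distrib_right nn_integral_add)
  qed
  have marg2: "emeasure \<gamma> (UNIV \<times> A) = emeasure \<nu> A" if [measurable]: "A \<in> sets borel" for A
  proof -
    have "(\<integral>\<^sup>+x\<in>A. b x \<partial>lborel) \<le> \<delta>"
      unfolding b_int[symmetric] by (intro nn_integral_mono) (simp add: indicator_def)
    then have "(\<integral>\<^sup>+x\<in>A. b x \<partial>lborel) * (k * \<delta>) = (\<integral>\<^sup>+x\<in>A. b x \<partial>lborel)"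
      by (rule k_cancel)
    then have "emeasure N1 UNIV * emeasure N2 A = (\<integral>\<^sup>+x\<in>A. b x \<partial>lborel)"
      unfolding N1_UNIV by (simp add: N2_def emeasure_density nn_integral_cmult mult.assoc) (simp add: ac_simps)
    then show ?thesis
      by (simp add: \<gamma>_emeasure \<nu>_def emeasure_density g_eq distrib_right nn_integral_add)
  qed
  have fst_m: "fst \<in> measurable \<gamma> \<mu>" and snd_m: "snd \<in> measurable \<gamma> \<nu>"
    by (simp_all add: measurable_cong_sets[OF \<gamma>_sets])
  have space_\<gamma>: "space \<gamma> = UNIV" using sets_eq_imp_space_eq[OF \<gamma>_sets] by (simp add: space_pair_measure)
  have "\<gamma> \<in> couplings \<mu> \<nu>"
    unfolding couplings_def
  proof (intro CollectI conjI)
    have "emeasure \<gamma> (UNIV \<times> UNIV) = 1" by (subst marg1) (simp_all add: \<mu>_def emeasure_density f1)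
    then show "prob_space \<gamma>" by (intro prob_spaceI) (simp add: space_\<gamma>)
    show "sets \<gamma> = sets (\<mu> \<Otimes>\<^sub>M \<nu>)"
      unfolding \<gamma>_sets by (intro sets_pair_measure_cong) auto
    show "distr \<gamma> \<mu> fst = \<mu>"
    proof (rule measure_eqI)
      fix A assume "A \<in> sets (distr \<gamma> \<mu> fst)"
      then show "emeasure (distr \<gamma> \<mu> fst) A = emeasure \<mu> A"
        using fst_m marg1[of A] by (simp add: emeasure_distr space_\<gamma> fst_vimage_eq_Times)
    qed simp
    show "distr \<gamma> \<nu> snd = \<nu>"
    proof (rule measure_eqI)
      fix A assume "A \<in> sets (distr \<gamma> \<nu> snd)"
      then show "emeasure (distr \<gamma> \<nu> snd) A = emeasure \<nu> A"
        using snd_m marg2[of A] by (simp add: emeasure_distr space_\<gamma> snd_vimage_eq_Times)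
    qed simp
  qed
  moreover have "(\<integral>\<^sup>+z. ennreal (norm (fst z - snd z) powr p) \<partial>\<gamma>)
    \<le> ennreal (2 powr p) * (\<integral>\<^sup>+x. ennreal (norm x powr p) * ennreal \<bar>f x - g x\<bar> \<partial>lborel)"
  proof -
    define n where "n x = ennreal (norm x powr p)" for x :: 'a
    have [measurable]: "n \<in> borel_measurable borel" unfolding n_def by measurable
    have [measurable]: "(\<lambda>z::'a \<times> 'a. ennreal (norm (fst z - snd z) powr p)) \<in> borel_measurable (borel \<Otimes>\<^sub>M borel)"
      by measurable
    have D0: "(\<integral>\<^sup>+z. ennreal (norm (fst z - snd z) powr p) \<partial>D) = 0"
      by (simp add: D_def nn_integral_distr)
    have N1_int: "integral\<^sup>N N1 h = (\<integral>\<^sup>+x. h x * a x \<partial>lborel)" if [measurable]: "h \<in> borel_measurable borel" for h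
      by (simp add: N1_def nn_integral_density mult.commute)
    have N2_int: "integral\<^sup>N N2 h = k * (\<integral>\<^sup>+x. h x * b x \<partial>lborel)" if [measurable]: "h \<in> borel_measurable borel" for h
      by (simp add: N2_def nn_integral_density nn_integral_cmult[symmetric] ac_simps)
    have n_N1 [measurable]: "n \<in> borel_measurable N1" and n_N2 [measurable]: "n \<in> borel_measurable N2"
      by (simp_all add: N1_def N2_def)
    have na: "(\<integral>\<^sup>+x. n x * a x \<partial>lborel) * (k * \<delta>) \<le> (\<integral>\<^sup>+x. n x * a x \<partial>lborel)"
      and nb: "(\<integral>\<^sup>+x. n x * b x \<partial>lborel) * (k * \<delta>) \<le> (\<integral>\<^sup>+x. n x * b x \<partial>lborel)"
      by (simp_all add: k)
    have "(\<integral>\<^sup>+z. ennreal (norm (fst z - snd z) powr p) \<partial>\<gamma>)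
        = (\<integral>\<^sup>+z. ennreal (norm (fst z - snd z) powr p) \<partial>(N1 \<Otimes>\<^sub>M N2))"
      unfolding \<gamma>_def by (subst nn_integral_add_measure) (simp_all add: N_sets D0 cong: measurable_cong_sets)
    also have "\<dots> \<le> (\<integral>\<^sup>+z. ennreal (2 powr p) * (n (fst z) + n (snd z)) \<partial>(N1 \<Otimes>\<^sub>M N2))"
      unfolding n_def
      by (intro nn_integral_mono)
        (use norm_diff_powr_le[OF p] in \<open>simp add: ennreal_mult[symmetric] ennreal_leI flip: ennreal_plus\<close>)
    also have "\<dots> = (\<integral>\<^sup>+x. \<integral>\<^sup>+y. ennreal (2 powr p) * (n x + n y) \<partial>N2 \<partial>N1)"
      by (subst N2.nn_integral_fst[symmetric]) (simp_all add: measurable_cong_sets[OF N_sets refl])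
    also have "\<dots> = ennreal (2 powr p) *
        ((\<integral>\<^sup>+x. n x * a x \<partial>lborel) * (k * \<delta>) + (\<integral>\<^sup>+x. n x * b x \<partial>lborel) * (k * \<delta>))"
    proof -
      have "(\<integral>\<^sup>+y. ennreal (2 powr p) * (n x + n y) \<partial>N2)
          = ennreal (2 powr p) * (n x * (k * \<delta>) + k * (\<integral>\<^sup>+y. n y * b y \<partial>lborel))" for x
        by (simp add: nn_integral_cmult nn_integral_add N2_UNIV N2_int)
      then show ?thesis
        by (simp add: nn_integral_cmult nn_integral_add nn_integral_multc N1_UNIV N1_int)
          (simp add: ac_simps)
    qed
    also have "\<dots> \<le> ennreal (2 powr p) * ((\<integral>\<^sup>+x. n x * a x \<partial>lborel) + (\<integral>\<^sup>+x. n x * b x \<partial>lborel))"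
      by (intro mult_left_mono add_mono na nb) simp
    also have "\<dots> = ennreal (2 powr p) * (\<integral>\<^sup>+x. n x * ennreal \<bar>f x - g x\<bar> \<partial>lborel)"
      by (simp add: nn_integral_add[symmetric] distrib_left[symmetric] ab)
    finally show ?thesis by (simp add: n_def)
  qed
  ultimately show ?thesis
    unfolding wasserstein_def \<mu>_def[symmetric] \<nu>_def[symmetric]
    by (intro INF_lower2[of \<gamma>] ennreal_powr_mono) (use p in auto)
qed

lemma measure_density_eq_integral:
  assumes f: "integrable M f" "\<And>x. 0 \<le> f x" and A: "A \<in> sets M"
  shows "measure (density M (\<lambda>x. ennreal (f x))) A = (LINT x|M. f x * indicator A x)"
proof -
  have "emeasure (density M (\<lambda>x. ennreal (f x))) A = (\<integral>\<^sup>+x. ennreal (f x * indicator A x) \<partial>M)"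
    using f A by (auto simp: emeasure_density indicator_def intro!: nn_integral_cong)
  also have "\<dots> = ennreal (LINT x|M. f x * indicator A x)"
    using f A by (intro nn_integral_eq_integral integrable_real_mult_indicator) auto
  finally show ?thesis
    using f by (simp add: measure_def integral_nonneg_AE)
qed

lemma tv_dist_normalized_le:
  fixes a b :: "'a::euclidean_space \<Rightarrow> real"
  assumes int: "integrable lborel a" "integrable lborel b"
    and ab: "\<And>x. 0 \<le> a x" "\<And>x. a x \<le> b x"
    and pos: "0 < integral\<^sup>L lborel a"
  shows "tv_dist (density lborel (\<lambda>x. ennreal (a x / integral\<^sup>L lborel a)))
      (density lborel (\<lambda>x. ennreal (b x / integral\<^sup>L lborel b)))
    \<le> (integral\<^sup>L lborel b - integral\<^sup>L lborel a) / integral\<^sup>L lborel a"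
  unfolding tv_dist_def
proof (rule cSUP_least)
  fix A :: "'a set" assume A: "A \<in> sets borel"
  define Za Zb \<alpha> \<beta> where "Za = integral\<^sup>L lborel a" and "Zb = integral\<^sup>L lborel b"
    and "\<alpha> = (LINT x|lborel. a x * indicator A x)" and "\<beta> = (LINT x|lborel. b x * indicator A x)"
  have Zab: "0 < Za" "Za \<le> Zb"
    using pos integral_mono[OF int ab(2)] by (auto simp: Za_def Zb_def)
  have b0: "0 \<le> b x" for x using ab[of x] by linarith
  have iA: "integrable lborel (\<lambda>x. a x * indicator A x)" "integrable lborel (\<lambda>x. b x * indicator A x)"
    using int A by (auto intro: integrable_real_mult_indicator)
  have "0 \<le> a x * indicator A x" "a x * indicator A x \<le> b x * indicator A x"
    "a x * indicator A x \<le> a x" for x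
    using ab[of x] by (simp_all add: indicator_def)
  then have le: "0 \<le> \<alpha>" "\<alpha> \<le> \<beta>" "\<alpha> \<le> Za"
    unfolding \<alpha>_def \<beta>_def Za_def
    by (simp_all only: Bochner_Integration.integral_nonneg integral_mono[OF iA] integral_mono[OF iA(1) int(1)])
  have "(LINT x|lborel. (b x - a x) * indicator A x) \<le> (LINT x|lborel. b x - a x)"
    using ab int A
    by (intro integral_mono integrable_real_mult_indicator) (auto simp: indicator_def)
  then have diff: "\<beta> - \<alpha> \<le> Zb - Za"
    using iA int by (simp add: left_diff_distrib \<alpha>_def \<beta>_def Za_def Zb_def)
  have m: "measure (density lborel (\<lambda>x. ennreal (a x / Za))) A = \<alpha> / Za"
    "measure (density lborel (\<lambda>x. ennreal (b x / Zb))) A = \<beta> / Zb"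
    using int ab(1) b0 A Zab by (simp_all add: measure_density_eq_integral \<alpha>_def \<beta>_def)
  have "\<beta> / Zb - \<alpha> / Za \<le> \<beta> / Zb - \<alpha> / Zb"
    using le Zab by (intro diff_left_mono divide_left_mono) auto
  also have "\<dots> \<le> (Zb - Za) / Zb"
    using diff Zab by (simp add: diff_divide_distrib[symmetric] divide_right_mono)
  also have "\<dots> \<le> (Zb - Za) / Za" using Zab by (intro divide_left_mono) auto
  finally have 1: "\<beta> / Zb - \<alpha> / Za \<le> (Zb - Za) / Za" .
  have "\<alpha> / Za - \<beta> / Zb \<le> \<alpha> / Za - \<alpha> / Zb"
    using le Zab by (intro diff_left_mono divide_right_mono) auto
  also have "\<dots> = \<alpha> / Zb * ((Zb - Za) / Za)" using Zab by (simp add: field_simps)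
  also have "\<dots> \<le> 1 * ((Zb - Za) / Za)" using Zab le by (intro mult_right_mono) auto
  finally have 2: "\<alpha> / Za - \<beta> / Zb \<le> (Zb - Za) / Za" by simp
  from 1 2 show "\<bar>measure (density lborel (\<lambda>x. ennreal (a x / integral\<^sup>L lborel a))) A
      - measure (density lborel (\<lambda>x. ennreal (b x / integral\<^sup>L lborel b))) A\<bar>
    \<le> (integral\<^sup>L lborel b - integral\<^sup>L lborel a) / integral\<^sup>L lborel a"
    unfolding Za_def[symmetric] Zb_def[symmetric] m by linarith
qed auto

lemma tv_dist_commute: "tv_dist \<mu> \<nu> = tv_dist \<nu> \<mu>"
  by (simp add: tv_dist_def abs_minus_commute)

lemma abs_diff_normalized_le:
  fixes u v :: real
  assumes "0 \<le> u" "u \<le> v" "0 < Z" "Z \<le> Zu" "Zu \<le> Zv"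
  shows "\<bar>u / Zu - v / Zv\<bar> \<le> (v - u) / Z + (Zv - Zu) / Z\<^sup>2 * u"
proof -
  have "v / Zv - u / Zu \<le> (v - u) / Zv"
    using assms divide_left_mono[of Zu Zv u] by (simp add: diff_divide_distrib)
  also have "\<dots> \<le> (v - u) / Z" using assms by (intro divide_left_mono) auto
  finally have 1: "v / Zv - u / Zu \<le> (v - u) / Z" .
  have "u / Zu - v / Zv \<le> u / Zu - u / Zv"
    using assms by (intro diff_left_mono divide_right_mono) auto
  also have "\<dots> = (Zv - Zu) * u / (Zu * Zv)" using assms by (simp add: field_simps)
  also have "\<dots> \<le> (Zv - Zu) * u / Z\<^sup>2"
    unfolding power2_eq_square using assms by (intro divide_left_mono mult_mono) auto
  finally have 2: "u / Zu - v / Zv \<le> (Zv - Zu) / Z\<^sup>2 * u" by simp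
  have "0 \<le> (v - u) / Z" "0 \<le> (Zv - Zu) / Z\<^sup>2 * u" using assms by auto
  with 1 2 show ?thesis by linarith
qed

theorem proposition4p22:
  fixes F G :: "'a::euclidean_space \<Rightarrow> real" and \<rho> M tmax :: real
  assumes F_nonneg: "\<And>x. 0 \<le> F x"
    and G_nonneg: "\<And>x. 0 \<le> G x"
    and integrable_U: "integrable lborel (\<lambda>x. exp (- (F x + G x)))"
    and F_smooth: "\<exists>gradF L. (\<forall>x. GDERIV F x :> gradF x) \<and> L-lipschitz_on UNIV gradF"
    and G_locally_bounded: "\<And>x. \<exists>e>0. bounded (G ` ball x e)"
    and \<rho>_pos: "0 < \<rho>"
    and G_weakly_convex: "convex_on UNIV (\<lambda>x. G x + \<rho> / 2 * (norm x)\<^sup>2)"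
    and G_lipschitz_or_integrable:
      "(\<exists>L. L-lipschitz_on UNIV G) \<or> integrable lborel (\<lambda>x. exp (- G x))"
    and M_pos: "0 < M"
    and G_convex_outside: "convex_outside_ball M G"
    and F_convex_outside: "convex_outside_ball M F"
    and tmax: "0 < tmax" "tmax < 1 / \<rho>"
    and K_finite: "K_max F G tmax < \<infinity>"
  shows "(\<forall>s\<in>{0..<tmax}. \<forall>t\<in>{0..<tmax}.
            tv_dist (smoothed_gibbs F G s) (smoothed_gibbs F G t)
              \<le> enn2real (K_max F G tmax) / (2 * partition_const F G 0)
                  * (1 + partition_const F G tmax / partition_const F G 0) * \<bar>s - t\<bar>)
       \<and> (\<forall>p\<ge>1.
            (\<integral>\<^sup>+ x. ennreal (norm x powr p) * (subgrad_bound G tmax (norm x))\<^sup>2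
                 * ennreal (exp (- smoothed_potential F G tmax x)) \<partial>lborel) < \<infinity>
            \<longrightarrow> (\<exists>C\<ge>0. \<forall>s\<in>{0..<tmax}. \<forall>t\<in>{0..<tmax}.
                   wasserstein p (smoothed_gibbs F G s) (smoothed_gibbs F G t)
                     \<le> ennreal (C * \<bar>s - t\<bar> powr (1 / p))))"
proof -
  define e where "e t x = exp (- smoothed_potential F G t x)" for t x
  define W where "W x = (subgrad_bound G tmax (norm x))\<^sup>2 * ennreal (e tmax x)" for x
  define Z where "Z t = integral\<^sup>L lborel (e t)" for t
  define K where "K = enn2real (K_max F G tmax)"
  have "continuous_on UNIV (\<lambda>x. (G x + \<rho> / 2 * (norm x)\<^sup>2) - \<rho> / 2 * (norm x)\<^sup>2)"
    by (intro continuous_on_diff[OF convex_on_continuous[OF open_UNIV G_weakly_convex]] continuous_intros)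
  also have "(\<lambda>x. (G x + \<rho> / 2 * (norm x)\<^sup>2) - \<rho> / 2 * (norm x)\<^sup>2) = G" by simp
  finally have G_cont: "continuous_on UNIV G" .
  obtain gradF where "\<And>x. GDERIV F x :> gradF x" using F_smooth by blast
  then have F_cont: "continuous_on UNIV F"
    by (intro continuous_at_imp_continuous_on ballI has_derivative_continuous) (simp add: gderiv_def)
  note G = G_nonneg G_cont
  have e_meas: "e t \<in> borel_measurable borel" if "0 \<le> t" for t
    using borel_measurable_moreau_envelope[OF G that] borel_measurable_continuous_onI[OF F_cont]
    unfolding e_def[abs_def] smoothed_potential_def by measurable
  have [measurable]: "e tmax \<in> borel_measurable borel" using tmax(1) by (simp add: e_meas)
  have "subgrad_bound G tmax \<in> borel_measurable borel"
    by (intro borel_measurable_mono_ennreal monoI subgrad_bound_mono)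
  then have W_meas [measurable]: "W \<in> borel_measurable borel"
    unfolding W_def[abs_def] by measurable
  have e_pos: "0 < e t x" for t x by (simp add: e_def)
  have e_mono: "e s x \<le> e t x" if "0 \<le> s" "s \<le> t" for s t x
    using exp_smoothed_potential_mono[of G s t F x] G that by (simp add: e_def)
  have e_diff: "ennreal (e t x - e s x) \<le> ennreal ((t - s) / 2) * W x" if "0 \<le> s" "s \<le> t" "t \<le> tmax" for s t x
    using exp_smoothed_potential_diff_le[OF G that, of F x] by (simp add: e_def W_def)
  have K: "integral\<^sup>N lborel W = ennreal K" "0 \<le> K"
    using K_finite by (simp_all add: K_def K_max_def W_def[abs_def] e_def less_top)
  have int_diff: "(\<integral>\<^sup>+x. ennreal (e t x - e s x) \<partial>lborel) \<le> ennreal ((t - s) / 2 * K)"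
    if st: "0 \<le> s" "s \<le> t" "t \<le> tmax" for s t
  proof -
    have "(\<integral>\<^sup>+x. ennreal (e t x - e s x) \<partial>lborel) \<le> (\<integral>\<^sup>+x. ennreal ((t - s) / 2) * W x \<partial>lborel)"
      by (intro nn_integral_mono e_diff st)
    also have "\<dots> = ennreal ((t - s) / 2) * ennreal K" by (simp add: nn_integral_cmult K)
    also have "\<dots> = ennreal ((t - s) / 2 * K)"
      using st K(2) by (intro ennreal_mult[symmetric]) auto
    finally show ?thesis .
  qed
  have e0: "integrable lborel (e 0)"
    using integrable_U by (simp add: e_def[abs_def] smoothed_potential_def moreau_envelope_def)
  have int_e: "integrable lborel (e t)" if "0 \<le> t" "t \<le> tmax" for t
  proof -
    have "integrable lborel (\<lambda>x. e t x - e 0 x)"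
    proof (rule integrableI_nonneg)
      show "(\<integral>\<^sup>+x. ennreal (e t x - e 0 x) \<partial>lborel) < \<infinity>"
        using int_diff[of 0 t] that by (auto intro: le_less_trans)
    qed (use that e_mono[of 0 t] in \<open>auto intro!: borel_measurable_diff e_meas\<close>)
    from Bochner_Integration.integrable_add[OF this e0] show ?thesis by simp
  qed
  have Z_diff: "Z t - Z s \<le> (t - s) / 2 * K" if "0 \<le> s" "s \<le> t" "t \<le> tmax" for s t
  proof -
    have int: "integrable lborel (e s)" "integrable lborel (e t)" using that by (auto intro: int_e)
    have "ennreal (Z t - Z s) = ennreal (LINT x|lborel. e t x - e s x)"
      using int by (simp add: Z_def)
    also have "\<dots> = (\<integral>\<^sup>+x. ennreal (e t x - e s x) \<partial>lborel)"
      using int e_mono[of s t] that by (intro nn_integral_eq_integral[symmetric]) auto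
    also have "\<dots> \<le> ennreal ((t - s) / 2 * K)" by (rule int_diff[OF that])
    finally show ?thesis using that K by (simp add: ennreal_le_iff)
  qed
  have Z_mono: "Z s \<le> Z t" if "0 \<le> s" "s \<le> t" "t \<le> tmax" for s t
    unfolding Z_def using that by (intro integral_mono int_e e_mono) auto
  have Z0: "0 < Z 0"
  proof -
    have "\<not> (AE x in lborel. e 0 x = 0)"
      using e_pos[of 0] AE_iff_measurable[of UNIV lborel "\<lambda>x. e 0 x = 0"] by (simp add: less_imp_neq[symmetric])
    then have "Z 0 \<noteq> 0"
      unfolding Z_def using e_pos[of 0]
      by (subst integral_nonneg_eq_0_iff_AE[OF e0]) (simp_all add: less_imp_le)
    moreover have "0 \<le> Z 0" unfolding Z_def using e_pos[of 0] by (simp add: less_imp_le)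
    ultimately show ?thesis by simp
  qed
  have Z_pos: "0 < Z t" "Z 0 \<le> Z t" if "0 \<le> t" "t \<le> tmax" for t
    using Z0 Z_mono[of 0 t] that by auto
  have part: "partition_const F G t = Z t" for t
    by (simp add: partition_const_def Z_def e_def[abs_def])
  have gibbs: "smoothed_gibbs F G t = density lborel (\<lambda>x. ennreal (e t x / Z t))" for t
    by (simp add: smoothed_gibbs_def part e_def)
  have tv: "tv_dist (smoothed_gibbs F G s) (smoothed_gibbs F G t) \<le> K / (2 * Z 0) * (1 + Z tmax / Z 0) * (t - s)"
    if st: "0 \<le> s" "s \<le> t" "t \<le> tmax" for s t
  proof -
    have "tv_dist (smoothed_gibbs F G s) (smoothed_gibbs F G t) \<le> (Z t - Z s) / Z s"
      unfolding gibbs Z_def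
      using st Z_pos(1)[of s] e_pos
      by (intro tv_dist_normalized_le int_e e_mono) (auto simp: Z_def intro: less_imp_le)
    also have "\<dots> \<le> ((t - s) / 2 * K) / Z 0"
      using Z_diff[OF st] Z_mono[OF st] Z_pos[of s] Z0 st by (intro frac_le) auto
    also have "\<dots> = K / (2 * Z 0) * 1 * (t - s)" by simp
    also have "\<dots> \<le> K / (2 * Z 0) * (1 + Z tmax / Z 0) * (t - s)"
      using K Z_pos[of tmax] tmax Z0 st by (intro mult_right_mono mult_left_mono) auto
    finally show ?thesis .
  qed
  have tv': "tv_dist (smoothed_gibbs F G s) (smoothed_gibbs F G t)
      \<le> K / (2 * Z 0) * (1 + Z tmax / Z 0) * \<bar>s - t\<bar>"
    if st: "0 \<le> s" "0 \<le> t" "s \<le> tmax" "t \<le> tmax" for s t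
  proof (cases "s \<le> t")
    case True
    then show ?thesis using tv[of s t] st by simp
  next
    case False
    then show ?thesis using tv[of t s] st by (subst tv_dist_commute) simp
  qed
  have wass: "\<exists>C\<ge>0. \<forall>s\<in>{0..<tmax}. \<forall>t\<in>{0..<tmax}.
      wasserstein p (smoothed_gibbs F G s) (smoothed_gibbs F G t) \<le> ennreal (C * \<bar>s - t\<bar> powr (1 / p))"
    if p: "1 \<le> p" and I_fin: "(\<integral>\<^sup>+x. ennreal (norm x powr p) * W x \<partial>lborel) < \<infinity>" for p
  proof -
    define I where "I = (\<integral>\<^sup>+x. ennreal (norm x powr p) * W x \<partial>lborel)"
    define J where "J s t = (\<integral>\<^sup>+x. ennreal (norm x powr p) * ennreal \<bar>e s x / Z s - e t x / Z t\<bar> \<partial>lborel)" for s t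
    have "\<exists>B\<ge>0. \<forall>s t. 0 \<le> s \<longrightarrow> s \<le> t \<longrightarrow> t \<le> tmax \<longrightarrow> J s t \<le> ennreal (B * (t - s))"
    proof (cases "\<exists>r. subgrad_bound G tmax r \<noteq> 0")
      case False
      then have "e s x = e t x" if "0 \<le> s" "s \<le> t" "t \<le> tmax" for s t x
        using e_diff[OF that, of x] e_mono[OF that(1,2), of x] by (simp add: W_def)
      then have "J s t = 0" if "0 \<le> s" "s \<le> t" "t \<le> tmax" for s t
        using that by (simp add: J_def Z_def cong: Bochner_Integration.integral_cong)
      then have "\<forall>s t. 0 \<le> s \<longrightarrow> s \<le> t \<longrightarrow> t \<le> tmax \<longrightarrow> J s t \<le> ennreal (0 * (t - s))" by simp
      then show ?thesis by blast
    next
      case True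
      then obtain r0 where r0: "subgrad_bound G tmax r0 \<noteq> 0" by blast
      define r where "r = \<bar>r0\<bar>"
      define q where "q = min 1 ((subgrad_bound G tmax r)\<^sup>2)"
      have "subgrad_bound G tmax r0 \<le> subgrad_bound G tmax r"
        by (rule subgrad_bound_mono) (simp add: r_def)
      then have "subgrad_bound G tmax r \<noteq> 0" using r0 by auto
      then have q: "q \<noteq> 0" "q < \<top>"
        by (auto simp: q_def min_def intro: le_less_trans[OF _ ennreal_one_less_top])
      define m where "m = ennreal (r powr p) * ennreal (Z tmax) + inverse q * I"
      text \<open>A positive value of \<open>\<phi>\<close> at radius \<open>r\<close> turns the weighted moment into a plain moment outside \<open>cball 0 r\<close>.\<close>
      have mom: "(\<integral>\<^sup>+x. ennreal (norm x powr p) * ennreal (e s x) \<partial>lborel) \<le> m" if s: "0 \<le> s" "s \<le> tmax" for s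
      proof -
        have "ennreal (norm x powr p) * ennreal (e s x)
            \<le> ennreal (r powr p) * ennreal (e tmax x) + inverse q * (ennreal (norm x powr p) * W x)" for x
        proof (cases "norm x \<le> r")
          case True
          then have "ennreal (norm x powr p) * ennreal (e s x) \<le> ennreal (r powr p) * ennreal (e tmax x)"
            using p s by (intro mult_mono ennreal_leI powr_mono2 e_mono) auto
          then show ?thesis by (rule order_trans) simp
        next
          case False
          then have "q \<le> (subgrad_bound G tmax (norm x))\<^sup>2"
            unfolding q_def by (intro min.coboundedI2 power_mono subgrad_bound_mono) auto
          then have "inverse q * q \<le> inverse q * (subgrad_bound G tmax (norm x))\<^sup>2"
            by (rule mult_left_mono) simp
          moreover have "inverse q * q = 1"
            using q by (simp add: mult.commute ennreal_divide_self flip: divide_ennreal_def)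
          ultimately have "1 \<le> inverse q * (subgrad_bound G tmax (norm x))\<^sup>2" by simp
          then have "ennreal (norm x powr p) * ennreal (e s x) * 1
              \<le> ennreal (norm x powr p) * ennreal (e tmax x) * (inverse q * (subgrad_bound G tmax (norm x))\<^sup>2)"
            using s by (intro mult_mono ennreal_leI e_mono) auto
          also have "\<dots> = inverse q * (ennreal (norm x powr p) * W x)" by (simp add: W_def ac_simps)
          finally show ?thesis by (simp add: add_increasing)
        qed
        then have "(\<integral>\<^sup>+x. ennreal (norm x powr p) * ennreal (e s x) \<partial>lborel)
          \<le> (\<integral>\<^sup>+x. ennreal (r powr p) * ennreal (e tmax x) + inverse q * (ennreal (norm x powr p) * W x) \<partial>lborel)"
          by (rule nn_integral_mono)
        also have "\<dots> = ennreal (r powr p) * (\<integral>\<^sup>+x. ennreal (e tmax x) \<partial>lborel) + inverse q * I"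
          by (simp add: nn_integral_add nn_integral_cmult I_def)
        also have "(\<integral>\<^sup>+x. ennreal (e tmax x) \<partial>lborel) = ennreal (Z tmax)"
          unfolding Z_def using tmax e_pos by (intro nn_integral_eq_integral int_e) (auto intro: less_imp_le)
        finally show ?thesis by (simp add: m_def)
      qed
      have "m < \<top>"
        using I_fin q unfolding m_def I_def
        by (auto simp: ennreal_mult_less_top less_top[symmetric] ennreal_mult_eq_top_iff ennreal_inverse_eq_top_iff)
      define B where "B = enn2real I / (2 * Z 0) + K / 2 / (Z 0)\<^sup>2 * enn2real m"
      have "J s t \<le> ennreal (B * (t - s))" if st: "0 \<le> s" "s \<le> t" "t \<le> tmax" for s t
      proof -
        define D where "D = (Z t - Z s) / (Z 0)\<^sup>2"
        have D: "0 \<le> D" "D \<le> (t - s) / 2 * K / (Z 0)\<^sup>2"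
          unfolding D_def using Z_mono[OF st] by (simp, intro divide_right_mono Z_diff[OF st]) simp
        have [measurable]: "e s \<in> borel_measurable borel" "e t \<in> borel_measurable borel"
          using st by (simp_all add: e_meas)
        define n where "n x = ennreal (norm x powr p)" for x :: 'a
        have [measurable]: "n \<in> borel_measurable borel" unfolding n_def by measurable
        have "n x * ennreal \<bar>e s x / Z s - e t x / Z t\<bar>
            \<le> ennreal ((t - s) / (2 * Z 0)) * (n x * W x) + ennreal D * (n x * ennreal (e s x))" for x
        proof -
          have "ennreal \<bar>e s x / Z s - e t x / Z t\<bar> \<le> ennreal ((e t x - e s x) / Z 0 + D * e s x)"
            unfolding D_def using st Z0 Z_pos[of s] Z_mono[OF st] e_pos[of s x]
            by (intro ennreal_leI abs_diff_normalized_le) (auto intro: e_mono)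
          also have "\<dots> = ennreal (1 / Z 0) * ennreal (e t x - e s x) + ennreal D * ennreal (e s x)"
            using Z0 D e_mono[OF st(1,2), of x] e_pos[of s x]
            by (subst ennreal_plus) (auto simp: ennreal_mult[symmetric])
          also have "\<dots> \<le> ennreal (1 / Z 0) * (ennreal ((t - s) / 2) * W x) + ennreal D * ennreal (e s x)"
            by (intro add_right_mono mult_left_mono e_diff st) simp
          also have "ennreal (1 / Z 0) * (ennreal ((t - s) / 2) * W x) = ennreal ((t - s) / (2 * Z 0)) * W x"
            using Z0 st by (subst mult.assoc[symmetric], subst ennreal_mult[symmetric]) (auto simp: mult.commute[of 2])
          finally have "n x * ennreal \<bar>e s x / Z s - e t x / Z t\<bar>
              \<le> n x * (ennreal ((t - s) / (2 * Z 0)) * W x + ennreal D * ennreal (e s x))"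
            by (rule mult_left_mono) simp
          then show ?thesis by (simp add: distrib_left ac_simps)
        qed
        then have "J s t \<le> (\<integral>\<^sup>+x. ennreal ((t - s) / (2 * Z 0)) * (n x * W x) + ennreal D * (n x * ennreal (e s x)) \<partial>lborel)"
          unfolding J_def n_def[symmetric] by (rule nn_integral_mono)
        also have "\<dots> = ennreal ((t - s) / (2 * Z 0)) * I + ennreal D * (\<integral>\<^sup>+x. n x * ennreal (e s x) \<partial>lborel)"
          by (simp add: nn_integral_add nn_integral_cmult I_def n_def[symmetric])
        also have "\<dots> \<le> ennreal ((t - s) / (2 * Z 0)) * I + ennreal ((t - s) / 2 * K / (Z 0)\<^sup>2) * m"
          unfolding n_def using st by (intro add_left_mono mult_mono ennreal_leI D mom) auto
        also have "\<dots> = ennreal (B * (t - s))"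
        proof -
          have "I = ennreal (enn2real I)" "m = ennreal (enn2real m)"
            using I_fin \<open>m < \<top>\<close> by (simp_all add: I_def less_top)
          moreover have "ennreal ((t - s) / (2 * Z 0)) * ennreal (enn2real I)
              + ennreal ((t - s) / 2 * K / (Z 0)\<^sup>2) * ennreal (enn2real m)
            = ennreal ((t - s) / (2 * Z 0) * enn2real I + (t - s) / 2 * K / (Z 0)\<^sup>2 * enn2real m)"
            using st Z0 K(2) by (subst ennreal_plus) (auto simp del: times_divide_eq_left simp: ennreal_mult)
          moreover have "(t - s) / (2 * Z 0) * enn2real I + (t - s) / 2 * K / (Z 0)\<^sup>2 * enn2real m = B * (t - s)"
            by (simp add: B_def algebra_simps)
          ultimately show ?thesis by metis
        qed
        finally show ?thesis .
      qed
      moreover have "0 \<le> B" using Z0 K by (simp add: B_def)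
      ultimately show ?thesis by blast
    qed
    then obtain B where B: "0 \<le> B" "\<And>s t. 0 \<le> s \<Longrightarrow> s \<le> t \<Longrightarrow> t \<le> tmax \<Longrightarrow> J s t \<le> ennreal (B * (t - s))"
      by blast
    have B': "J s t \<le> ennreal (B * \<bar>s - t\<bar>)" if "0 \<le> s" "0 \<le> t" "s \<le> tmax" "t \<le> tmax" for s t
    proof (cases "s \<le> t")
      case False
      then have "J t s \<le> ennreal (B * (s - t))" using that B(2)[of t s] by simp
      then show ?thesis using False by (simp add: J_def abs_minus_commute)
    qed (use that B(2)[of s t] in simp)
    have norm1: "(\<integral>\<^sup>+x. ennreal (e t x / Z t) \<partial>lborel) = 1" if "0 \<le> t" "t \<le> tmax" for t
    proof -
      have "(\<integral>\<^sup>+x. ennreal (e t x / Z t) \<partial>lborel) = ennreal (LINT x|lborel. e t x / Z t)"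
        using that e_pos Z_pos[OF that]
        by (intro nn_integral_eq_integral AE_I2 divide_nonneg_nonneg) (auto intro: int_e less_imp_le)
      also have "(LINT x|lborel. e t x / Z t) = 1"
        using Z_pos[OF that] by (simp add: Z_def)
      finally show ?thesis by simp
    qed
    define C where "C = (2 powr p * B) powr (1 / p)"
    have "wasserstein p (smoothed_gibbs F G s) (smoothed_gibbs F G t) \<le> ennreal (C * \<bar>s - t\<bar> powr (1 / p))"
      if st: "s \<in> {0..<tmax}" "t \<in> {0..<tmax}" for s t
    proof -
      have "wasserstein p (smoothed_gibbs F G s) (smoothed_gibbs F G t)
          \<le> ennreal_powr (ennreal (2 powr p) * J s t) (1 / p)"
        unfolding gibbs J_def
        using st p Z_pos(1) e_pos by (intro wasserstein_density_le norm1) (auto simp: less_imp_le intro!: borel_measurable_divide e_meas)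
      also have "\<dots> \<le> ennreal_powr (ennreal (2 powr p * B * \<bar>s - t\<bar>)) (1 / p)"
      proof (rule ennreal_powr_mono)
        have "ennreal (2 powr p) * J s t \<le> ennreal (2 powr p) * ennreal (B * \<bar>s - t\<bar>)"
          using st by (intro mult_left_mono B') auto
        then show "ennreal (2 powr p) * J s t \<le> ennreal (2 powr p * B * \<bar>s - t\<bar>)"
          using B(1) by (simp add: ennreal_mult mult.assoc)
      qed (use p in simp)
      also have "\<dots> = ennreal (C * \<bar>s - t\<bar> powr (1 / p))"
        using B(1) by (simp add: ennreal_powr_def C_def powr_mult)
      finally show ?thesis .
    qed
    moreover have "0 \<le> C" by (simp add: C_def)
    ultimately show ?thesis by blast
  qed
  show ?thesis
  proof (intro conjI ballI allI impI)
    fix s t assume st: "s \<in> {0..<tmax}" "t \<in> {0..<tmax}"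
    show "tv_dist (smoothed_gibbs F G s) (smoothed_gibbs F G t)
        \<le> enn2real (K_max F G tmax) / (2 * partition_const F G 0)
          * (1 + partition_const F G tmax / partition_const F G 0) * \<bar>s - t\<bar>"
      using tv'[of s t] st by (simp add: part K_def)
  next
    fix p :: real
    assume "1 \<le> p" and "(\<integral>\<^sup>+x. ennreal (norm x powr p) * (subgrad_bound G tmax (norm x))\<^sup>2
        * ennreal (exp (- smoothed_potential F G tmax x)) \<partial>lborel) < \<infinity>"
    then have "1 \<le> p" "(\<integral>\<^sup>+x. ennreal (norm x powr p) * W x \<partial>lborel) < \<infinity>"
      by (simp_all add: W_def e_def mult.assoc)
    then show "\<exists>C\<ge>0. \<forall>s\<in>{0..<tmax}. \<forall>t\<in>{0..<tmax}.
        wasserstein p (smoothed_gibbs F G s) (smoothed_gibbs F G t) \<le> ennreal (C * \<bar>s - t\<bar> powr (1 / p))"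
      by (rule wass)
  qed
qed

end
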